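(* Let $n\ge 2$ be an integer and let $H(x,y)=xy+H_{n+1}(x,y)$, where $H_{n+1}\in\mathbb{C}[x,y]$ is a homogeneous polynomial of degree $n+1$. Then at each isolated critical point of $H$ in $\mathbb{C}^2$, the polynomial $H$ has type $\mathbf{A}_k$ (for some $k\ge1$). In particular, $H$ has type $\mathbf{A}_1$ at each isolated critical point lying on $L_0=\{(x,y)\in\mathbb{C}^2:H(x,y)=0\}$.
   Context: A polynomial function $f$ on $\mathbb{C}^2$ has type $\mathbf{A}_k$ ($k\ge1$) at an isolated critical point $p$ if there is a local holomorphic change of coordinates $(x,y)\mapsto(z,w)$ in a neighborhood of $p$, sending $p$ to $(0,0)$, which transforms $f-f(p)$ to $z^2+w^{k+1}$. Type $\mathbf{A}_1$ is equivalent to $p$ being a non-degenerate critical point, i.e. the Hessian matrix of $f$ at $p$ is non-degenerate. *)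

theory Defs
  imports "HOL-Analysis.Analysis" "HOL-Computational_Algebra.Polynomial"
begin

text \<open>
  Elements of \<open>\<complex>[x,y]\<close> are represented in \<open>\<complex>[x][y]\<close>: the coefficient of \<open>x\<^sup>i y\<^sup>j\<close> in \<open>P\<close> is
  \<open>coeff (coeff P j) i\<close>.
\<close>

definition poly2 :: "complex poly poly \<Rightarrow> complex \<Rightarrow> complex \<Rightarrow> complex" where
  "poly2 P x y = poly (poly P [:y:]) x"

text \<open>As a graded piece of \<open>\<complex>[x,y]\<close>, so the zero polynomial is homogeneous of every degree.\<close>

definition homogeneous2 :: "nat \<Rightarrow> complex poly poly \<Rightarrow> bool" where
  "homogeneous2 d P \<longleftrightarrow> (\<forall>i j. coeff (coeff P j) i \<noteq> 0 \<longrightarrow> i + j = d)"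

definition critical_point :: "(complex \<times> complex \<Rightarrow> complex) \<Rightarrow> complex \<times> complex \<Rightarrow> bool" where
  "critical_point f p \<longleftrightarrow> (f has_derivative (\<lambda>v. 0)) (at p)"

definition isolated_critical_point ::
    "(complex \<times> complex \<Rightarrow> complex) \<Rightarrow> complex \<times> complex \<Rightarrow> bool" where
  "isolated_critical_point f p \<longleftrightarrow> p isolated_in {q. critical_point f q}"

text \<open>
  Holomorphy in two variables: the real Frechet derivative exists at every point and is
  \<open>\<complex>\<close>-linear.
\<close>

definition holomorphic2_on ::
    "(complex \<times> complex \<Rightarrow> complex) \<Rightarrow> (complex \<times> complex) set \<Rightarrow> bool" where
  "holomorphic2_on f U \<longleftrightarrow>
     (\<forall>p\<in>U. \<exists>a b. (f has_derivative (\<lambda>(s, t). a * s + b * t)) (at p within U))"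

definition biholomorphism2 ::
    "(complex \<times> complex) set \<Rightarrow> (complex \<times> complex) set \<Rightarrow>
     (complex \<times> complex \<Rightarrow> complex \<times> complex) \<Rightarrow>
     (complex \<times> complex \<Rightarrow> complex \<times> complex) \<Rightarrow> bool" where
  "biholomorphism2 U V \<phi> \<psi> \<longleftrightarrow>
     open U \<and> open V \<and> homeomorphism U V \<phi> \<psi> \<and>
     holomorphic2_on (fst \<circ> \<phi>) U \<and> holomorphic2_on (snd \<circ> \<phi>) U \<and>
     holomorphic2_on (fst \<circ> \<psi>) V \<and> holomorphic2_on (snd \<circ> \<psi>) V"

definition type_A ::
    "nat \<Rightarrow> (complex \<times> complex \<Rightarrow> complex) \<Rightarrow> complex \<times> complex \<Rightarrow> bool" where
  "type_A k f p \<longleftrightarrow>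
     k \<ge> 1 \<and> isolated_critical_point f p \<and>
     (\<exists>U V \<phi> \<psi>. biholomorphism2 U V \<phi> \<psi> \<and> p \<in> U \<and> \<phi> p = (0, 0) \<and>
        (\<forall>q\<in>U. f q - f p = fst (\<phi> q) ^ 2 + snd (\<phi> q) ^ (k + 1)))"

end

theory Submission
  imports Defs "HOL-Complex_Analysis.Complex_Analysis"
begin

text \<open>
  The theorem has an analytic and an algebraic half.
  
  The analytic half is the splitting lemma in two variables: at an isolated critical point where the
  Hessian matrix is not zero, a function has type \<open>\<^bold>A\<^sub>k\<close> for some \<open>k\<close>, and \<open>k = 1\<close> if the Hessian
  determinant is nonzero. After a linear change of coordinates \<open>f\<^sub>x\<^sub>x \<noteq> 0\<close>, so \<open>f\<^sub>x = 0\<close> is a curve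
  \<open>x = h y\<close>; completing the square around it leaves a function of \<open>y\<close> alone, which is a power of a local
  coordinate up to a constant (\<open>splitting_lemma\<close>, \<open>type_A_at_nonzero_hessian\<close>). The new coordinates are
  holomorphic by a holomorphic inverse function theorem (\<open>holomorphic2_inverse_function\<close>). Because \<open>f\<close>
  is a polynomial, completing the square is a division of polynomials (\<open>poly2_second_order_division\<close>).
  
  The algebraic half shows that the Hessian of \<open>H = x y + P\<close> never vanishes at a critical point. There
  \<open>P\<^sub>x = - y\<close> and \<open>P\<^sub>y = - x\<close>. A zero Hessian means \<open>P\<^sub>x\<^sub>x = P\<^sub>y\<^sub>y = 0\<close> and \<open>P\<^sub>x\<^sub>y = - 1\<close>, so Euler's
  relation \<open>x P\<^sub>x\<^sub>x + y P\<^sub>x\<^sub>y = n P\<^sub>x\<close> becomes \<open>- y = - n y\<close>, whence \<open>y = 0\<close> and likewise \<open>x = 0\<close>; but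
  at the origin \<open>P\<^sub>x\<^sub>y = 0\<close>. If moreover \<open>H = 0\<close>, then Euler's relation for \<open>P\<close> gives \<open>x y = 0\<close>. At such a
  point the product of the pure second derivatives of \<open>H\<close> vanishes, while the mixed one is \<open>1\<close> at the
  origin and \<open>1 - n\<close> elsewhere, so the Hessian determinant is nonzero.
\<close>

section \<open>Continuously differentiable holomorphic functions of two variables\<close>

text \<open>
  Continuity of the partial derivatives is part of the notion because the inverse function theorem
  asks for it. Sums, products and composition with holomorphic functions of one variable inherit it.
\<close>

definition C1_holomorphic2_on ::
    "(complex \<times> complex \<Rightarrow> complex) \<Rightarrow> (complex \<times> complex) set \<Rightarrow> bool" where
  "C1_holomorphic2_on f U \<longleftrightarrow>
     (\<exists>a b. continuous_on U a \<and> continuous_on U b \<and>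
        (\<forall>p\<in>U. (f has_derivative (\<lambda>v. a p * fst v + b p * snd v)) (at p)))"

lemma C1_holomorphic2_onI:
  assumes "continuous_on U a" "continuous_on U b"
    and "\<And>p. p \<in> U \<Longrightarrow> (f has_derivative (\<lambda>v. a p * fst v + b p * snd v)) (at p)"
  shows "C1_holomorphic2_on f U"
  using assms unfolding C1_holomorphic2_on_def by blast

lemma C1_holomorphic2_onE:
  assumes "C1_holomorphic2_on f U"
  obtains a b where "continuous_on U a" "continuous_on U b"
    "\<And>p. p \<in> U \<Longrightarrow> (f has_derivative (\<lambda>v. a p * fst v + b p * snd v)) (at p)"
  using assms unfolding C1_holomorphic2_on_def by blast

lemma C1_holomorphic2_on_subset:
  "C1_holomorphic2_on f U \<Longrightarrow> U' \<subseteq> U \<Longrightarrow> C1_holomorphic2_on f U'"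
  unfolding C1_holomorphic2_on_def by (meson continuous_on_subset subsetD)

lemma C1_holomorphic2_on_imp_continuous_on:
  assumes "C1_holomorphic2_on f U"
  shows "continuous_on U f"
  using assms by (meson C1_holomorphic2_onE continuous_at_imp_continuous_on has_derivative_continuous)

lemma holomorphic2_onI:
  assumes "\<And>p. p \<in> U \<Longrightarrow> \<exists>a b. (f has_derivative (\<lambda>v. a * fst v + b * snd v)) (at p)"
  shows "holomorphic2_on f U"
  unfolding holomorphic2_on_def case_prod_beta using assms by (meson has_derivative_at_withinI)

lemma C1_holomorphic2_on_imp_holomorphic2_on:
  "C1_holomorphic2_on f U \<Longrightarrow> holomorphic2_on f U"
  unfolding C1_holomorphic2_on_def by (blast intro: holomorphic2_onI)

named_theorems C1_intros

lemma C1_holomorphic2_on_const [C1_intros]: "C1_holomorphic2_on (\<lambda>p. c) U"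
  by (rule C1_holomorphic2_onI[of _ "\<lambda>p. 0" "\<lambda>p. 0"]) (auto intro!: continuous_intros)

lemma C1_holomorphic2_on_fst [C1_intros]: "C1_holomorphic2_on (\<lambda>p. fst p) U"
  by (rule C1_holomorphic2_onI[of _ "\<lambda>p. 1" "\<lambda>p. 0"])
     (auto intro!: continuous_intros derivative_eq_intros)

lemma C1_holomorphic2_on_snd [C1_intros]: "C1_holomorphic2_on (\<lambda>p. snd p) U"
  by (rule C1_holomorphic2_onI[of _ "\<lambda>p. 0" "\<lambda>p. 1"])
     (auto intro!: continuous_intros derivative_eq_intros)

lemma C1_holomorphic2_on_add [C1_intros]:
  assumes "C1_holomorphic2_on f U" "C1_holomorphic2_on g U"
  shows "C1_holomorphic2_on (\<lambda>p. f p + g p) U"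
proof -
  obtain a b where ab: "continuous_on U a" "continuous_on U b"
    "\<And>p. p \<in> U \<Longrightarrow> (f has_derivative (\<lambda>v. a p * fst v + b p * snd v)) (at p)"
    using assms(1) by (rule C1_holomorphic2_onE) blast
  obtain c d where cd: "continuous_on U c" "continuous_on U d"
    "\<And>p. p \<in> U \<Longrightarrow> (g has_derivative (\<lambda>v. c p * fst v + d p * snd v)) (at p)"
    using assms(2) by (rule C1_holomorphic2_onE) blast
  show ?thesis
    by (rule C1_holomorphic2_onI[of _ "\<lambda>p. a p + c p" "\<lambda>p. b p + d p"])
       (auto intro!: continuous_intros ab cd has_derivative_eq_rhs[OF has_derivative_add[OF ab(3) cd(3)]]
             simp: algebra_simps)
qed

lemma C1_holomorphic2_on_mult [C1_intros]:
  assumes "C1_holomorphic2_on f U" "C1_holomorphic2_on g U"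
  shows "C1_holomorphic2_on (\<lambda>p. f p * g p) U"
proof -
  obtain a b where ab: "continuous_on U a" "continuous_on U b"
    "\<And>p. p \<in> U \<Longrightarrow> (f has_derivative (\<lambda>v. a p * fst v + b p * snd v)) (at p)"
    using assms(1) by (rule C1_holomorphic2_onE) blast
  obtain c d where cd: "continuous_on U c" "continuous_on U d"
    "\<And>p. p \<in> U \<Longrightarrow> (g has_derivative (\<lambda>v. c p * fst v + d p * snd v)) (at p)"
    using assms(2) by (rule C1_holomorphic2_onE) blast
  have fg: "continuous_on U f" "continuous_on U g"
    using assms by (auto intro: C1_holomorphic2_on_imp_continuous_on)
  show ?thesis
    by (rule C1_holomorphic2_onI[of _ "\<lambda>p. f p * c p + a p * g p" "\<lambda>p. f p * d p + b p * g p"])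
       (auto intro!: continuous_intros ab cd fg has_derivative_eq_rhs[OF has_derivative_mult[OF ab(3) cd(3)]]
             simp: algebra_simps)
qed

lemma C1_holomorphic2_on_diff [C1_intros]:
  assumes "C1_holomorphic2_on f U" "C1_holomorphic2_on g U"
  shows "C1_holomorphic2_on (\<lambda>p. f p - g p) U"
  using C1_holomorphic2_on_add[OF assms(1)
      C1_holomorphic2_on_mult[OF C1_holomorphic2_on_const[of "-1"] assms(2)]]
  by simp

lemma C1_holomorphic2_on_compose:
  assumes g: "g holomorphic_on W" and W: "open W" and f: "C1_holomorphic2_on f U" and sub: "f ` U \<subseteq> W"
  shows "C1_holomorphic2_on (\<lambda>p. g (f p)) U"
proof -
  obtain a b where ab: "continuous_on U a" "continuous_on U b"
    "\<And>p. p \<in> U \<Longrightarrow> (f has_derivative (\<lambda>v. a p * fst v + b p * snd v)) (at p)"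
    using f by (rule C1_holomorphic2_onE) blast
  have "continuous_on W (deriv g)"
    using g W by (intro holomorphic_on_imp_continuous_on holomorphic_deriv)
  then have cont: "continuous_on U (\<lambda>p. deriv g (f p))"
    by (rule continuous_on_compose2[OF _ C1_holomorphic2_on_imp_continuous_on[OF f] sub])
  have der: "((\<lambda>p. g (f p)) has_derivative
      (\<lambda>v. deriv g (f p) * a p * fst v + deriv g (f p) * b p * snd v)) (at p)" if "p \<in> U" for p
  proof -
    have "(g has_field_derivative deriv g (f p)) (at (f p))"
      using g W sub that holomorphic_derivI by blast
    then have "(g has_derivative (*) (deriv g (f p))) (at (f p))"
      by (simp add: has_field_derivative_def)
    from has_derivative_compose[OF ab(3)[OF that] this] show ?thesis
      by (simp add: algebra_simps)
  qed
  show ?thesis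
    by (rule C1_holomorphic2_onI[OF _ _ der]) (auto intro!: continuous_intros ab cont)
qed

section \<open>Holomorphic inverse and implicit functions\<close>

lemma complex_linear2_unique:
  assumes "(f has_derivative (\<lambda>v. a * fst v + b * snd v)) (at (p :: complex \<times> complex))"
    and "(f has_derivative (\<lambda>v. c * fst v + d * snd v)) (at p)"
  shows "a = c" "b = (d :: complex)"
proof -
  have eq: "(\<lambda>v. a * fst v + b * snd v) = (\<lambda>v. c * fst v + d * snd v)"
    using assms by (rule has_derivative_unique)
  show "a = c" using fun_cong[OF eq, of "(1, 0)"] by simp
  show "b = d" using fun_cong[OF eq, of "(0, 1)"] by simp
qed

lemma bounded_linear_matrix2:
  "bounded_linear (\<lambda>v. (a * fst v + b * snd v, c * fst v + d * snd v :: complex))"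
  by (intro bounded_linear_Pair bounded_linear_add bounded_linear_mult_right[THEN bounded_linear_compose]
        bounded_linear_fst bounded_linear_snd)

lemma inverse_matrix2:
  assumes "a * d - b * c \<noteq> (0::complex)"
  shows "inv (\<lambda>v. (a * fst v + b * snd v, c * fst v + d * snd v)) =
    (\<lambda>v. (d / (a * d - b * c) * fst v + - b / (a * d - b * c) * snd v,
          - c / (a * d - b * c) * fst v + a / (a * d - b * c) * snd v))" (is "inv ?f = ?g")
proof (rule inv_unique_comp)
  define D where "D = a * d - b * c"
  have D: "D \<noteq> 0" using assms D_def by simp
  have 1: "a * (d / D * s + - b / D * t) + b * (- c / D * s + a / D * t) = s" for s t
    using D by (simp add: divide_simps) (simp add: D_def algebra_simps)
  have 2: "c * (d / D * s + - b / D * t) + d * (- c / D * s + a / D * t) = t" for s t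
    using D by (simp add: divide_simps) (simp add: D_def algebra_simps)
  have 3: "d / D * (a * s + b * t) + - b / D * (c * s + d * t) = s" for s t
    using D by (simp add: divide_simps) (simp add: D_def algebra_simps)
  have 4: "- c / D * (a * s + b * t) + a / D * (c * s + d * t) = t" for s t
    using D by (simp add: divide_simps) (simp add: D_def algebra_simps)
  show "?f \<circ> ?g = id" using 1 2 unfolding D_def by (auto simp: fun_eq_iff)
  show "?g \<circ> ?f = id" using 3 4 unfolding D_def by (auto simp: fun_eq_iff)
qed

lemma bij_matrix2_imp_det_nonzero:
  assumes "bij (\<lambda>v. (a * fst v + b * snd v, c * fst v + d * snd v :: complex))" (is "bij ?f")
  shows "a * d - b * c \<noteq> 0"
proof
  assume D: "a * d - b * c = 0"
  have inj: "inj ?f" using assms by (rule bij_is_inj)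
  have "?f (d, -c) = ?f (0, 0)" using D by (simp add: algebra_simps)
  then have cd: "c = 0" "d = 0" using injD[OF inj] by (metis Pair_inject neg_equal_0_iff_equal)+
  have "?f (b, -a) = ?f (0, 0)" using cd by (simp add: algebra_simps)
  then have ab: "a = 0" "b = 0" using injD[OF inj] by (metis Pair_inject neg_equal_0_iff_equal)+
  have "?f (1, 0) = ?f (0, 0)" using cd ab by simp
  then show False using injD[OF inj] by (metis Pair_inject one_neq_zero)
qed

text \<open>
  The real inverse function theorem provides a differentiable inverse whose derivative is the inverse
  of a complex \<open>2 \<times> 2\<close> matrix. Such an inverse is again a complex matrix, by Cramer's rule, so
  the inverse map is holomorphic.
\<close>

lemma holomorphic2_inverse_function:
  assumes U: "open U" "p \<in> U"
    and A: "C1_holomorphic2_on A U" and B: "C1_holomorphic2_on B U"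
    and dA: "(A has_derivative (\<lambda>v. a * fst v + b * snd v)) (at p)"
    and dB: "(B has_derivative (\<lambda>v. c * fst v + d * snd v)) (at p)"
    and det: "a * d - b * c \<noteq> 0"
  obtains U' V \<psi> where "U' \<subseteq> U" "p \<in> U'" "biholomorphism2 U' V (\<lambda>q. (A q, B q)) \<psi>"
proof -
  obtain a' b' where ab: "continuous_on U a'" "continuous_on U b'"
    "\<And>p. p \<in> U \<Longrightarrow> (A has_derivative (\<lambda>v. a' p * fst v + b' p * snd v)) (at p)"
    using A by (rule C1_holomorphic2_onE) blast
  obtain c' d' where cd: "continuous_on U c'" "continuous_on U d'"
    "\<And>p. p \<in> U \<Longrightarrow> (B has_derivative (\<lambda>v. c' p * fst v + d' p * snd v)) (at p)"
    using B by (rule C1_holomorphic2_onE) blast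
  define M where "M = (\<lambda>a b c d. Blinfun (\<lambda>v. (a * fst v + b * snd v, c * fst v + d * snd v :: complex)))"
  have M: "blinfun_apply (M a b c d) = (\<lambda>v. (a * fst v + b * snd v, c * fst v + d * snd v))" for a b c d
    unfolding M_def by (rule bounded_linear_Blinfun_apply[OF bounded_linear_matrix2])
  define F where "F = (\<lambda>q. M (a' q) (b' q) (c' q) (d' q))"
  have der: "((\<lambda>q. (A q, B q)) has_derivative blinfun_apply (F q)) (at q)" if "q \<in> U" for q
    unfolding F_def M by (intro has_derivative_Pair ab cd that)
  have cont: "continuous_on U F"
    by (rule continuous_on_blinfun_componentwise)
       (auto simp: F_def M intro!: continuous_intros ab cd)
  have abcd: "a' p = a" "b' p = b" "c' p = c" "d' p = d"
    using complex_linear2_unique[OF ab(3)[OF U(2)] dA] complex_linear2_unique[OF cd(3)[OF U(2)] dB] by auto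
  define D where "D = a * d - b * c"
  define N where "N = M (d / D) (- b / D) (- c / D) (a / D)"
  have inv: "N o\<^sub>L F p = id_blinfun"
  proof (rule blinfun_eqI)
    fix v
    have "D \<noteq> 0" using det D_def by simp
    then show "blinfun_apply (N o\<^sub>L F p) v = blinfun_apply id_blinfun v"
      by (cases v) (auto simp: N_def F_def M abcd divide_simps, auto simp: D_def algebra_simps)
  qed
  obtain U' V g g' where g: "open U'" "U' \<subseteq> U" "p \<in> U'" "open V" "(A p, B p) \<in> V"
    "homeomorphism U' V (\<lambda>q. (A q, B q)) g"
    "\<And>y. y \<in> V \<Longrightarrow> (g has_derivative (g' y)) (at y)"
    "\<And>y. y \<in> V \<Longrightarrow> g' y = inv (blinfun_apply (F (g y)))"
    "\<And>y. y \<in> V \<Longrightarrow> bij (blinfun_apply (F (g y)))"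
    by (rule inverse_function_theorem[OF U(1) der cont U(2) inv]) blast+
  have dg: "\<exists>a b c d. (g has_derivative (\<lambda>v. (a * fst v + b * snd v, c * fst v + d * snd v))) (at y)"
    if "y \<in> V" for y
  proof -
    have "a' (g y) * d' (g y) - b' (g y) * c' (g y) \<noteq> 0"
      using g(9)[OF that] unfolding F_def M by (rule bij_matrix2_imp_det_nonzero)
    from inverse_matrix2[OF this] show ?thesis
      using g(7)[OF that] unfolding g(8)[OF that] F_def M by (simp only:) blast
  qed
  have "holomorphic2_on (\<lambda>y. fst (g y)) V"
  proof (rule holomorphic2_onI)
    fix y assume "y \<in> V"
    from dg[OF this] obtain a b c d where
      "(g has_derivative (\<lambda>v. (a * fst v + b * snd v, c * fst v + d * snd v))) (at y)" by blast
    from has_derivative_fst[OF this]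
    show "\<exists>a b. ((\<lambda>y. fst (g y)) has_derivative (\<lambda>v. a * fst v + b * snd v)) (at y)" by auto
  qed
  moreover have "holomorphic2_on (\<lambda>y. snd (g y)) V"
  proof (rule holomorphic2_onI)
    fix y assume "y \<in> V"
    from dg[OF this] obtain a b c d where
      "(g has_derivative (\<lambda>v. (a * fst v + b * snd v, c * fst v + d * snd v))) (at y)" by blast
    from has_derivative_snd[OF this]
    show "\<exists>a b. ((\<lambda>y. snd (g y)) has_derivative (\<lambda>v. a * fst v + b * snd v)) (at y)" by auto
  qed
  ultimately have "biholomorphism2 U' V (\<lambda>q. (A q, B q)) g"
    unfolding biholomorphism2_def comp_def
    using g A B C1_holomorphic2_on_subset C1_holomorphic2_on_imp_holomorphic2_on by auto
  then show thesis using that g by blast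
qed

text \<open>
  Since \<open>F\<close> has nonzero first partial derivative, \<open>(F, snd)\<close> is a local change of
  coordinates. It preserves the second coordinate, so its inverse maps the axis \<open>F = 0\<close> to a graph
  over that coordinate.
\<close>

lemma holomorphic_implicit_function:
  assumes U: "open U" "(x0, y0) \<in> U" and F: "C1_holomorphic2_on F U" and F0: "F (x0, y0) = 0"
    and dF: "(F has_derivative (\<lambda>v. a * fst v + b * snd v)) (at (x0, y0))" and a: "a \<noteq> 0"
  obtains h r where "r > 0" "h holomorphic_on ball y0 r" "h y0 = x0"
    "\<And>y. y \<in> ball y0 r \<Longrightarrow> F (h y, y) = 0"
proof -
  have dsnd: "(snd has_derivative (\<lambda>v. 0 * fst v + 1 * snd v)) (at (x0, y0))"
    by (auto intro!: derivative_eq_intros)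
  obtain U' V \<psi> where UV: "U' \<subseteq> U" "(x0, y0) \<in> U'" "biholomorphism2 U' V (\<lambda>q. (F q, snd q)) \<psi>"
    by (rule holomorphic2_inverse_function[OF U F C1_holomorphic2_on_snd dF dsnd]) (use a in auto)
  have V: "open V" and hom: "homeomorphism U' V (\<lambda>q. (F q, snd q)) \<psi>"
    and hol: "holomorphic2_on (fst \<circ> \<psi>) V"
    using UV(3) unfolding biholomorphism2_def by auto
  have inv: "F (\<psi> y) = fst y" "snd (\<psi> y) = snd y" if "y \<in> V" for y
    using homeomorphism_apply2[OF hom that] by (metis fst_conv snd_conv)+
  have psi0: "\<psi> (0, y0) = (x0, y0)"
    using homeomorphism_apply1[OF hom UV(2)] F0 by simp
  have V0: "(0, y0) \<in> V"
    using hom UV(2) F0 unfolding homeomorphism_def by force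
  have "open ((\<lambda>y. (0::complex, y)) -` V)"
    by (intro open_vimage V continuous_intros)
  then obtain r where r: "r > 0" "ball y0 r \<subseteq> (\<lambda>y. (0, y)) -` V"
    using V0 openE by (metis vimageI)
  define h where "h = (\<lambda>y. fst (\<psi> (0, y)))"
  have "h holomorphic_on ball y0 r"
  proof (rule holomorphic_onI, rule field_differentiable_at_within)
    fix y assume "y \<in> ball y0 r"
    then have y: "(0, y) \<in> V" using r by auto
    then obtain a b where d1: "((fst \<circ> \<psi>) has_derivative (\<lambda>v. a * fst v + b * snd v)) (at (0, y))"
      using hol V unfolding holomorphic2_on_def case_prod_beta by (metis at_within_open)
    have d2: "((\<lambda>y. (0::complex, y)) has_derivative (\<lambda>t. (0, t))) (at y)"
      by (auto intro!: derivative_eq_intros)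
    have "((\<lambda>y. (fst \<circ> \<psi>) (0, y)) has_derivative (\<lambda>t. b * t)) (at y)"
      using has_derivative_compose[OF d2 d1] by simp
    then show "h field_differentiable at y"
      unfolding field_differentiable_def has_field_derivative_def h_def by auto
  qed
  moreover have "F (h y, y) = 0" if "y \<in> ball y0 r" for y
  proof -
    have "(0, y) \<in> V" using r that by auto
    from inv[OF this] show ?thesis unfolding h_def by (metis fst_conv prod.collapse snd_conv)
  qed
  moreover have "h y0 = x0" by (simp add: h_def psi0)
  ultimately show thesis using that r by blast
qed

section \<open>Biholomorphisms\<close>

lemma holomorphic2_on_compose:
  assumes f: "holomorphic2_on f U" and U: "open U"
    and a: "holomorphic2_on (fst \<circ> \<alpha>) W" "holomorphic2_on (snd \<circ> \<alpha>) W" and W: "open W"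
    and sub: "\<alpha> ` W \<subseteq> U"
  shows "holomorphic2_on (f \<circ> \<alpha>) W"
proof (rule holomorphic2_onI)
  fix p assume p: "p \<in> W"
  obtain a b where ab: "((\<lambda>p. fst (\<alpha> p)) has_derivative (\<lambda>v. a * fst v + b * snd v)) (at p)"
    using a(1) p W at_within_open[OF p W] unfolding holomorphic2_on_def case_prod_beta comp_def by metis
  obtain c d where cd: "((\<lambda>p. snd (\<alpha> p)) has_derivative (\<lambda>v. c * fst v + d * snd v)) (at p)"
    using a(2) p W at_within_open[OF p W] unfolding holomorphic2_on_def case_prod_beta comp_def by metis
  have ap: "\<alpha> p \<in> U" using p sub by auto
  obtain k l where kl: "(f has_derivative (\<lambda>v. k * fst v + l * snd v)) (at (\<alpha> p))"
    using f ap at_within_open[OF ap U] unfolding holomorphic2_on_def case_prod_beta by metis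
  have "(\<alpha> has_derivative (\<lambda>v. (a * fst v + b * snd v, c * fst v + d * snd v))) (at p)"
    using has_derivative_Pair[OF ab cd] by simp
  from has_derivative_compose[OF this kl]
  have "((\<lambda>p. f (\<alpha> p)) has_derivative (\<lambda>v. (k * a + l * c) * fst v + (k * b + l * d) * snd v)) (at p)"
    by (simp add: algebra_simps)
  then show "\<exists>a b. (f \<circ> \<alpha> has_derivative (\<lambda>v. a * fst v + b * snd v)) (at p)"
    unfolding comp_def by blast
qed

lemma biholomorphism2_compose_global:
  assumes \<alpha>: "biholomorphism2 UNIV UNIV \<alpha> \<beta>" and \<phi>: "biholomorphism2 U V \<phi> \<psi>"
  shows "biholomorphism2 (\<alpha> -` U) V (\<phi> \<circ> \<alpha>) (\<beta> \<circ> \<psi>)"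
proof -
  have hom: "homeomorphism UNIV UNIV \<alpha> \<beta>" using \<alpha> by (simp add: biholomorphism2_def)
  have inv: "\<beta> (\<alpha> q) = q" "\<alpha> (\<beta> q) = q" for q
    using homeomorphism_apply1[OF hom] homeomorphism_apply2[OF hom] by simp_all
  have img: "\<alpha> ` (\<alpha> -` U) = U" "\<beta> ` U = \<alpha> -` U"
  proof -
    show "\<alpha> ` (\<alpha> -` U) = U" using inv(2) by (metis surjI surj_image_vimage_eq)
    show "\<beta> ` U = \<alpha> -` U"
    proof
      show "\<beta> ` U \<subseteq> \<alpha> -` U" by (auto simp: inv simp del: split_paired_All)
      show "\<alpha> -` U \<subseteq> \<beta> ` U" by (metis image_eqI inv(1) subsetI vimageD)
    qed
  qed
  have "homeomorphism (\<alpha> -` U) U \<alpha> \<beta>"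
    using hom img inv unfolding homeomorphism_def by (auto intro: continuous_on_subset)
  then have homeo: "homeomorphism (\<alpha> -` U) V (\<phi> \<circ> \<alpha>) (\<beta> \<circ> \<psi>)"
    by (rule homeomorphism_compose) (use \<phi> in \<open>simp add: biholomorphism2_def\<close>)
  have op: "open (\<alpha> -` U)"
    using \<alpha> \<phi> by (intro open_vimage) (auto simp: biholomorphism2_def homeomorphism_def)
  have "holomorphic2_on (fst \<circ> \<alpha>) (\<alpha> -` U)" "holomorphic2_on (snd \<circ> \<alpha>) (\<alpha> -` U)"
    using \<alpha> unfolding biholomorphism2_def holomorphic2_on_def
    by (meson UNIV_I has_derivative_subset subset_UNIV)+
  with op have "holomorphic2_on ((fst \<circ> \<phi>) \<circ> \<alpha>) (\<alpha> -` U)"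
    "holomorphic2_on ((snd \<circ> \<phi>) \<circ> \<alpha>) (\<alpha> -` U)"
    using \<phi> img(1) unfolding biholomorphism2_def
    by (auto intro: holomorphic2_on_compose[where U = U])
  moreover have "holomorphic2_on ((fst \<circ> \<beta>) \<circ> \<psi>) V" "holomorphic2_on ((snd \<circ> \<beta>) \<circ> \<psi>) V"
    using \<alpha> \<phi> unfolding biholomorphism2_def
    by (auto intro: holomorphic2_on_compose[where U = UNIV])
  ultimately show ?thesis
    using \<phi> op homeo unfolding biholomorphism2_def comp_assoc by simp
qed

lemma biholomorphism2_affine:
  assumes det: "a * d - b * c \<noteq> 0"
  defines "D \<equiv> a * d - b * c"
  shows "biholomorphism2 UNIV UNIV
    (\<lambda>p. ((d * (fst p - e) - b * (snd p - f)) / D, (a * (snd p - f) - c * (fst p - e)) / D))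
    (\<lambda>p. (e + a * fst p + b * snd p, f + c * fst p + d * snd p))"
    (is "biholomorphism2 _ _ ?M ?L")
proof -
  have D: "D \<noteq> 0" using det D_def by simp
  have 1: "?L (?M p) = p" for p
    using D by (auto simp: prod_eq_iff divide_simps) (auto simp: D_def algebra_simps)
  have 2: "?M (?L p) = p" for p
    using D by (auto simp: prod_eq_iff divide_simps) (auto simp: D_def algebra_simps)
  have lin: "holomorphic2_on (\<lambda>p. k + l * fst p + m * snd p) UNIV" for k l m
    by (intro C1_holomorphic2_on_imp_holomorphic2_on C1_intros)
  have lin': "holomorphic2_on (\<lambda>p. (k * (fst p - e) - l * (snd p - f)) / D) UNIV"
    "holomorphic2_on (\<lambda>p. (k * (snd p - f) - l * (fst p - e)) / D) UNIV" for k l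
    unfolding divide_inverse
    by (intro C1_holomorphic2_on_imp_holomorphic2_on C1_intros)+
  have "homeomorphism UNIV UNIV ?M ?L"
    by (rule homeomorphismI) (use 1 2 D in \<open>auto intro!: continuous_intros\<close>)
  then show ?thesis
    unfolding biholomorphism2_def comp_def fst_conv snd_conv
    using lin[of e a b] lin[of f c d] lin'(1)[of d b] lin'(2)[of a c] by simp
qed

section \<open>Partial derivatives of polynomials in two variables\<close>

definition pderiv_x :: "complex poly poly \<Rightarrow> complex poly poly" where
  "pderiv_x Q = map_poly pderiv Q"

definition pderiv_y :: "complex poly poly \<Rightarrow> complex poly poly" where
  "pderiv_y Q = pderiv Q"

lemma coeff_pderiv_x: "coeff (coeff (pderiv_x Q) j) i = of_nat (Suc i) * coeff (coeff Q j) (Suc i)"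
  by (simp add: pderiv_x_def coeff_map_poly coeff_pderiv)

lemma coeff_pderiv_y: "coeff (coeff (pderiv_y Q) j) i = of_nat (Suc j) * coeff (coeff Q (Suc j)) i"
  by (simp add: pderiv_y_def coeff_pderiv of_nat_poly)

lemma pderiv_x_pderiv_y_commute: "pderiv_x (pderiv_y Q) = pderiv_y (pderiv_x Q)"
  by (intro poly_eqI) (simp only: coeff_pderiv_x coeff_pderiv_y mult.left_commute)

lemma pderiv_x_add: "pderiv_x (Q + R) = pderiv_x Q + pderiv_x R"
  by (intro poly_eqI) (simp add: coeff_pderiv_x algebra_simps)

lemma pderiv_y_add: "pderiv_y (Q + R) = pderiv_y Q + pderiv_y R"
  by (simp add: pderiv_y_def pderiv_add)

lemma pderiv_x_pCons: "pderiv_x (pCons a Q) = pCons (pderiv a) (pderiv_x Q)"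
  by (intro poly_eqI) (simp add: coeff_pderiv_x coeff_pCons coeff_pderiv split: nat.split)

lemma pderiv_y_pCons: "pderiv_y (pCons a Q) = Q + pCons 0 (pderiv_y Q)"
  by (simp add: pderiv_y_def pderiv_pCons)

lemma poly2_0: "poly2 0 x y = 0"
  by (simp add: poly2_def)

lemma poly2_pCons: "poly2 (pCons a Q) x y = poly a x + y * poly2 Q x y"
  by (simp add: poly2_def)

lemma poly2_add: "poly2 (Q + R) x y = poly2 Q x y + poly2 R x y"
  by (simp add: poly2_def)

lemma poly2_mult: "poly2 (Q * R) x y = poly2 Q x y * poly2 R x y"
  by (simp add: poly2_def)

lemma has_derivative_poly2:
  "((\<lambda>p. poly2 Q (fst p) (snd p)) has_derivative
    (\<lambda>v. poly2 (pderiv_x Q) (fst p) (snd p) * fst v + poly2 (pderiv_y Q) (fst p) (snd p) * snd v)) (at p)"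
proof (induction Q)
  case 0
  then show ?case by (simp add: poly2_0 pderiv_x_def pderiv_y_def)
next
  case (pCons a Q)
  have "((\<lambda>p. poly a (fst p)) has_derivative (\<lambda>v. poly (pderiv a) (fst p) * fst v)) (at p)"
    by (rule has_derivative_compose[of fst fst, OF _
          poly_DERIV[of a "fst p", unfolded has_field_derivative_def]])
       (auto intro!: derivative_eq_intros)
  then show ?case
    by (auto simp: poly2_pCons poly2_add pderiv_x_pCons pderiv_y_pCons algebra_simps
        intro!: derivative_eq_intros pCons.IH)
qed

lemma C1_holomorphic2_on_poly2: "C1_holomorphic2_on (\<lambda>p. poly2 Q (fst p) (snd p)) U"
proof -
  have "continuous_on U (\<lambda>p. poly2 R (fst p) (snd p))" for R
    by (intro continuous_at_imp_continuous_on ballI has_derivative_continuous[OF has_derivative_poly2])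
  from C1_holomorphic2_onI[OF this this has_derivative_poly2] show ?thesis .
qed

lemma critical_point_poly2_iff:
  "critical_point (\<lambda>p. poly2 Q (fst p) (snd p)) p \<longleftrightarrow>
     poly2 (pderiv_x Q) (fst p) (snd p) = 0 \<and> poly2 (pderiv_y Q) (fst p) (snd p) = 0"
proof
  assume "critical_point (\<lambda>p. poly2 Q (fst p) (snd p)) p"
  then have "((\<lambda>p. poly2 Q (fst p) (snd p)) has_derivative (\<lambda>v. 0 * fst v + 0 * snd v)) (at p)"
    by (simp add: critical_point_def)
  from complex_linear2_unique[OF has_derivative_poly2 this]
  show "poly2 (pderiv_x Q) (fst p) (snd p) = 0 \<and> poly2 (pderiv_y Q) (fst p) (snd p) = 0" by simp
next
  assume "poly2 (pderiv_x Q) (fst p) (snd p) = 0 \<and> poly2 (pderiv_y Q) (fst p) (snd p) = 0"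
  then show "critical_point (\<lambda>p. poly2 Q (fst p) (snd p)) p"
    using has_derivative_poly2[of Q p] by (simp add: critical_point_def)
qed

lemma poly2_along_graph_has_derivative:
  assumes "(h has_field_derivative h') (at y)"
  shows "((\<lambda>y. poly2 Q (h y) y) has_field_derivative
    poly2 (pderiv_x Q) (h y) y * h' + poly2 (pderiv_y Q) (h y) y) (at y)"
proof -
  have "((\<lambda>y. (h y, y)) has_derivative (\<lambda>t. (h' * t, t))) (at y)"
    using assms unfolding has_field_derivative_def by (auto intro!: derivative_eq_intros)
  from has_derivative_compose[OF this has_derivative_poly2[of Q]]
  have "((\<lambda>y. poly2 Q (h y) y) has_derivative
      (\<lambda>t. poly2 (pderiv_x Q) (h y) y * (h' * t) + poly2 (pderiv_y Q) (h y) y * t)) (at y)" by simp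
  then show ?thesis
    unfolding has_field_derivative_def by (rule has_derivative_eq_rhs) (simp add: fun_eq_iff algebra_simps)
qed

text \<open>
  An affine change of coordinates keeps a function within the polynomials, where the division with
  remainder used for the splitting lemma is available.
\<close>

lemma poly2_affine_substitution:
  "\<exists>R. \<forall>x y. poly2 R x y = poly2 Q (e + a * x + b * y) (f + c * x + d * y)"
proof -
  have lin: "\<exists>R. \<forall>x y. poly2 R x y = k + l * x + m * y" for k l m
    by (rule exI[of _ "[:[:k, l:], [:m:]:]"]) (simp add: poly2_def algebra_simps)
  have uni: "\<exists>R. \<forall>x y. poly2 R x y = poly q (e + a * x + b * y)" for q
  proof (induction q)
    case 0
    then show ?case by (intro exI[of _ 0]) (simp add: poly2_0)
  next
    case (pCons k q)
    then obtain R where R: "\<And>x y. poly2 R x y = poly q (e + a * x + b * y)" by blast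
    obtain S where S: "\<And>x y. poly2 S x y = e + a * x + b * y" using lin by blast
    show ?case
      by (rule exI[of _ "[:[:k:]:] + S * R"]) (simp add: poly2_add poly2_mult R S, simp add: poly2_def)
  qed
  show ?thesis
  proof (induction Q)
    case 0
    then show ?case by (intro exI[of _ 0]) (simp add: poly2_0)
  next
    case (pCons q Q)
    then obtain R where R: "\<And>x y. poly2 R x y = poly2 Q (e + a * x + b * y) (f + c * x + d * y)" by blast
    obtain S where S: "\<And>x y. poly2 S x y = f + c * x + d * y" using lin by blast
    obtain T where T: "\<And>x y. poly2 T x y = poly q (e + a * x + b * y)" using uni by blast
    show ?case
      by (rule exI[of _ "T + S * R"]) (simp add: poly2_add poly2_mult poly2_pCons R S T)
  qed
qed

text \<open>
  Both sides are coefficients of the derivative of one and the same function of two variables, and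
  the derivative determines its coefficients.
\<close>

lemma poly2_affine_chain_rule:
  assumes "\<And>x y. poly2 R x y = poly2 Q (e + a * x + b * y) (f + c * x + d * y)"
  shows "poly2 (pderiv_x R) x y = poly2 (pderiv_x Q) (e + a * x + b * y) (f + c * x + d * y) * a +
                            poly2 (pderiv_y Q) (e + a * x + b * y) (f + c * x + d * y) * c"
    and "poly2 (pderiv_y R) x y = poly2 (pderiv_x Q) (e + a * x + b * y) (f + c * x + d * y) * b +
                            poly2 (pderiv_y Q) (e + a * x + b * y) (f + c * x + d * y) * d"
proof -
  define L where "L = (\<lambda>p. (e + a * fst p + b * snd p, f + c * fst p + d * snd p))"
  have "(L has_derivative (\<lambda>v. (a * fst v + b * snd v, c * fst v + d * snd v))) (at (x, y))"
    unfolding L_def by (auto intro!: derivative_eq_intros)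
  from has_derivative_compose[OF this has_derivative_poly2[of Q]]
  have "((\<lambda>p. poly2 R (fst p) (snd p)) has_derivative
     (\<lambda>v. (poly2 (pderiv_x Q) (e + a * x + b * y) (f + c * x + d * y) * a +
           poly2 (pderiv_y Q) (e + a * x + b * y) (f + c * x + d * y) * c) * fst v +
          (poly2 (pderiv_x Q) (e + a * x + b * y) (f + c * x + d * y) * b +
           poly2 (pderiv_y Q) (e + a * x + b * y) (f + c * x + d * y) * d) * snd v)) (at (x, y))"
    by (simp add: L_def assms algebra_simps)
  from complex_linear2_unique[OF has_derivative_poly2 this]
  show "poly2 (pderiv_x R) x y = poly2 (pderiv_x Q) (e + a * x + b * y) (f + c * x + d * y) * a +
                            poly2 (pderiv_y Q) (e + a * x + b * y) (f + c * x + d * y) * c"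
    and "poly2 (pderiv_y R) x y = poly2 (pderiv_x Q) (e + a * x + b * y) (f + c * x + d * y) * b +
                            poly2 (pderiv_y Q) (e + a * x + b * y) (f + c * x + d * y) * d"
    by simp_all
qed

section \<open>Second-order division along a graph\<close>

text \<open>
  Taylor's formula to second order with base point \<open>h y\<close> moving holomorphically. For polynomials
  the quotient of the remainder by \<open>(x - h y)\<^sup>2\<close> is given by a recursion along the coefficients
  (if \<open>E\<close> belongs to \<open>q\<close>, then \<open>q'(h y) + x E\<close> belongs to \<open>x q + c\<close>), which shows that it is
  holomorphic in both variables together. Its value on the graph \<open>x = h y\<close> is what makes \<open>E\<close> nonzero
  where the second derivative of \<open>q\<close> is.
\<close>

lemma poly_second_order_division:
  assumes h: "h holomorphic_on V" and V: "open V"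
  shows "\<exists>E. C1_holomorphic2_on E (UNIV \<times> V) \<and>
    (\<forall>x. \<forall>y\<in>V. poly q x = poly q (h y) + (x - h y) * poly (pderiv q) (h y) + (x - h y)^2 * E (x, y)) \<and>
    (\<forall>y\<in>V. 2 * E (h y, y) = poly (pderiv (pderiv q)) (h y))"
proof (induction q)
  case 0
  show ?case by (rule exI[of _ "\<lambda>p. 0"]) (auto intro!: C1_intros)
next
  case (pCons c q)
  then obtain E where E: "C1_holomorphic2_on E (UNIV \<times> V)"
    "\<And>x y. y \<in> V \<Longrightarrow> poly q x = poly q (h y) + (x - h y) * poly (pderiv q) (h y) + (x - h y)^2 * E (x, y)"
    "\<And>y. y \<in> V \<Longrightarrow> 2 * E (h y, y) = poly (pderiv (pderiv q)) (h y)" by blast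
  have "(\<lambda>y. poly (pderiv q) (h y)) holomorphic_on V"
    using h by (intro holomorphic_intros)
  then have "C1_holomorphic2_on (\<lambda>p. poly (pderiv q) (h (snd p))) (UNIV \<times> V)"
    by (rule C1_holomorphic2_on_compose[OF _ V C1_holomorphic2_on_snd]) auto
  then have "C1_holomorphic2_on (\<lambda>p. poly (pderiv q) (h (snd p)) + fst p * E p) (UNIV \<times> V)"
    by (intro C1_intros E)
  moreover have "poly (pCons c q) x = poly (pCons c q) (h y) + (x - h y) * poly (pderiv (pCons c q)) (h y)
      + (x - h y)^2 * (poly (pderiv q) (h (snd (x, y))) + fst (x, y) * E (x, y))" if "y \<in> V" for x y
    by (simp add: pderiv_pCons E(2)[OF that, of x] power2_eq_square algebra_simps)
  moreover have "2 * (poly (pderiv q) (h (snd (h y, y))) + fst (h y, y) * E (h y, y))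
     = poly (pderiv (pderiv (pCons c q))) (h y)" if "y \<in> V" for y
    using E(3)[OF that] by (simp add: pderiv_pCons pderiv_add)
  ultimately show ?case
    by (intro exI[of _ "\<lambda>p. poly (pderiv q) (h (snd p)) + fst p * E p"]) blast
qed

lemma poly2_second_order_division:
  assumes h: "h holomorphic_on V" and V: "open V"
  shows "\<exists>E. C1_holomorphic2_on E (UNIV \<times> V) \<and>
    (\<forall>x. \<forall>y\<in>V. poly2 Q x y = poly2 Q (h y) y + (x - h y) * poly2 (pderiv_x Q) (h y) y + (x - h y)^2 * E (x, y)) \<and>
    (\<forall>y\<in>V. 2 * E (h y, y) = poly2 (pderiv_x (pderiv_x Q)) (h y) y)"
proof (induction Q)
  case 0
  show ?case by (rule exI[of _ "\<lambda>p. 0"]) (auto intro!: C1_intros simp: poly2_0 pderiv_x_def)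
next
  case (pCons q Q)
  then obtain E where E: "C1_holomorphic2_on E (UNIV \<times> V)"
    "\<And>x y. y \<in> V \<Longrightarrow> poly2 Q x y = poly2 Q (h y) y + (x - h y) * poly2 (pderiv_x Q) (h y) y + (x - h y)^2 * E (x, y)"
    "\<And>y. y \<in> V \<Longrightarrow> 2 * E (h y, y) = poly2 (pderiv_x (pderiv_x Q)) (h y) y" by blast
  obtain F where F: "C1_holomorphic2_on F (UNIV \<times> V)"
    "\<And>x y. y \<in> V \<Longrightarrow> poly q x = poly q (h y) + (x - h y) * poly (pderiv q) (h y) + (x - h y)^2 * F (x, y)"
    "\<And>y. y \<in> V \<Longrightarrow> 2 * F (h y, y) = poly (pderiv (pderiv q)) (h y)"
    using poly_second_order_division[OF assms, of q] by blast
  have "C1_holomorphic2_on (\<lambda>p. F p + snd p * E p) (UNIV \<times> V)"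
    by (intro C1_intros E F)
  moreover have "poly2 (pCons q Q) x y = poly2 (pCons q Q) (h y) y + (x - h y) * poly2 (pderiv_x (pCons q Q)) (h y) y
      + (x - h y)^2 * (F (x, y) + snd (x, y) * E (x, y))" if "y \<in> V" for x y
    unfolding pderiv_x_pCons poly2_pCons E(2)[OF that, of x] F(2)[OF that, of x] by (simp add: algebra_simps)
  moreover have "2 * (F (h y, y) + snd (h y, y) * E (h y, y)) = poly2 (pderiv_x (pderiv_x (pCons q Q))) (h y) y"
    if "y \<in> V" for y
    using E(3)[OF that] F(3)[OF that] by (simp add: pderiv_x_pCons poly2_pCons algebra_simps)
  ultimately show ?case
    by (intro exI[of _ "\<lambda>p. F p + snd p * E p"]) blast
qed

section \<open>The splitting lemma\<close>

text \<open>
  Since \<open>f\<^sub>x\<^sub>x \<noteq> 0\<close>, the equation \<open>f\<^sub>x = 0\<close> defines a curve \<open>x = h y\<close> through the origin. Expanding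
  around this curve kills the linear term: \<open>f(x, y) = \<phi> y + (x - h y)\<^sup>2 E(x, y)\<close> with
  \<open>E(0, 0) \<noteq> 0\<close>, where \<open>\<phi>\<close> is the restriction of \<open>f\<close> to the curve. If \<open>\<phi>\<close> were constant, the whole
  curve would consist of critical points and the origin would not be isolated; so
  \<open>\<phi> y - \<phi> 0 = (y g y)\<^sup>n\<close> with \<open>g 0 \<noteq> 0\<close>. Then \<open>z = (x - h y) \<surd>E\<close> and \<open>w = y g y\<close>
  are the required coordinates. The exponent is at least 2 because the gradient vanishes, and it equals 2 when
  \<open>\<phi>''(0)\<close>, which is the Hessian determinant divided by \<open>f\<^sub>x\<^sub>x\<close>, is nonzero.
\<close>

lemma splitting_lemma:
  defines "f Q \<equiv> \<lambda>p. poly2 Q (fst p) (snd p)"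
  assumes iso: "isolated_critical_point (f Q) (0, 0)"
    and nz: "poly2 (pderiv_x (pderiv_x Q)) 0 0 \<noteq> 0"
  obtains k where "type_A k (f Q) (0, 0)"
    "poly2 (pderiv_x (pderiv_x Q)) 0 0 * poly2 (pderiv_y (pderiv_y Q)) 0 0 - (poly2 (pderiv_x (pderiv_y Q)) 0 0)\<^sup>2 \<noteq> 0 \<Longrightarrow> k = 1"
proof -
  have crit: "poly2 (pderiv_x Q) 0 0 = 0" "poly2 (pderiv_y Q) 0 0 = 0"
    using iso critical_point_poly2_iff[of Q "(0, 0)"]
    unfolding isolated_critical_point_def isolated_in_def f_def by auto
  obtain h r where r: "r > 0" and h: "h holomorphic_on ball 0 r" and h0: "h 0 = 0"
    and Qx: "\<And>y. y \<in> ball 0 r \<Longrightarrow> poly2 (pderiv_x Q) (h y) y = 0"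
    by (rule holomorphic_implicit_function[OF open_UNIV UNIV_I C1_holomorphic2_on_poly2[of "pderiv_x Q"] _
          has_derivative_poly2[of "pderiv_x Q"], of 0 0]) (use crit nz in auto)
  have dh: "(h has_field_derivative deriv h y) (at y)" if "y \<in> ball 0 r" for y
    using h that holomorphic_derivI by blast
  define \<phi> where "\<phi> = (\<lambda>y. poly2 Q (h y) y)"
  have d\<phi>: "(\<phi> has_field_derivative poly2 (pderiv_y Q) (h y) y) (at y)" if "y \<in> ball 0 r" for y
    using poly2_along_graph_has_derivative[OF dh[OF that], of Q] Qx[OF that] by (simp add: \<phi>_def)
  have hol\<phi>: "\<phi> holomorphic_on ball 0 r"
    using d\<phi> by (meson field_differentiable_at_within field_differentiable_def holomorphic_onI)
  have "\<exists>n>0. (deriv ^^ n) \<phi> 0 \<noteq> 0"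
  proof (rule ccontr)
    assume "\<not> ?thesis"
    then have z: "(deriv ^^ i) \<phi> 0 = 0" if "i > 0" for i
      using that by blast
    have const: "\<phi> y = \<phi> 0" if "y \<in> ball 0 r" for y
      by (intro holomorphic_fun_eq_const_on_connected[OF hol\<phi>]) (use r that z in auto)
    have Qy: "poly2 (pderiv_y Q) (h y) y = 0" if "y \<in> ball 0 r" for y
    proof -
      have "(\<phi> has_field_derivative 0) (at y)"
        by (rule has_field_derivative_transform_within_open[of "\<lambda>_. \<phi> 0" _ _ "ball 0 r"])
           (use that const in auto)
      then show ?thesis using d\<phi>[OF that] DERIV_unique by blast
    qed
    obtain T where T: "open T" "T \<inter> {q. critical_point (f Q) q} = {(0, 0)}"
      using iso unfolding isolated_critical_point_def isolated_in_def by auto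
    have "continuous_on (ball 0 r) (\<lambda>y. (h y, y))"
      using h by (intro continuous_intros holomorphic_on_imp_continuous_on)
    then have "open (ball 0 r \<inter> (\<lambda>y. (h y, y)) -` T)"
      using T(1) by (intro continuous_open_preimage) auto
    moreover have "0 \<in> ball 0 r \<inter> (\<lambda>y. (h y, y)) -` T"
      using r h0 T(2) by auto
    ultimately obtain \<epsilon> where \<epsilon>: "\<epsilon> > 0" "ball 0 \<epsilon> \<subseteq> ball 0 r \<inter> (\<lambda>y. (h y, y)) -` T"
      by (meson openE)
    define y where "y = complex_of_real (\<epsilon> / 2)"
    have y: "y \<noteq> 0" "y \<in> ball 0 \<epsilon>" using \<epsilon>(1) by (auto simp: y_def)
    then have "y \<in> ball 0 r" "(h y, y) \<in> T" using \<epsilon>(2) by auto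
    moreover have "critical_point (f Q) (h y, y)"
      using critical_point_poly2_iff[of Q "(h y, y)"] Qx Qy \<open>y \<in> ball 0 r\<close> by (simp add: f_def)
    ultimately show False using T(2) y(1) by auto
  qed
  then obtain n where n: "n > 0" "(deriv ^^ n) \<phi> 0 \<noteq> 0"
    and least: "\<And>i. 0 < i \<Longrightarrow> i < n \<Longrightarrow> (deriv ^^ i) \<phi> 0 = 0"
    using exists_least_iff[of "\<lambda>n. 0 < n \<and> (deriv ^^ n) \<phi> 0 \<noteq> 0"] by blast
  \<comment> \<open>The derivative of \<open>\<phi>\<close> is \<open>f\<^sub>y\<close> along the curve, so the vanishing gradient excludes order 1.\<close>
  have "deriv \<phi> 0 = 0"
    using DERIV_imp_deriv[OF d\<phi>[of 0]] r h0 crit by simp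
  then have "n \<noteq> 1" using n(2) by auto
  then have n2: "n \<ge> 2" using n(1) by simp
  obtain g r' where r': "r' > 0" and g: "g holomorphic_on ball 0 r'"
    and \<phi>g: "\<And>y. y \<in> ball 0 r' \<Longrightarrow> \<phi> y - \<phi> 0 = ((y - 0) * g y) ^ n"
    and g0: "\<And>y. y \<in> ball 0 r' \<Longrightarrow> g y \<noteq> 0"
  proof (rule holomorphic_factor_order_of_zero_strong[OF hol\<phi> open_ball
        centre_in_ball[THEN iffD2, OF r] n least])
    fix g r'
    assume "r' > 0" "g holomorphic_on ball 0 r'"
      "\<And>y. y \<in> ball 0 r' \<Longrightarrow> \<phi> y - \<phi> 0 = ((y - 0) * g y) ^ n"
      "\<And>y. y \<in> ball 0 r' \<Longrightarrow> g y \<noteq> 0"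
    then show thesis by (rule that)
  qed
  obtain E where E: "C1_holomorphic2_on E (UNIV \<times> ball 0 r)"
    "\<And>x y. y \<in> ball 0 r \<Longrightarrow>
       poly2 Q x y = poly2 Q (h y) y + (x - h y) * poly2 (pderiv_x Q) (h y) y + (x - h y)\<^sup>2 * E (x, y)"
    "\<And>y. y \<in> ball 0 r \<Longrightarrow> 2 * E (h y, y) = poly2 (pderiv_x (pderiv_x Q)) (h y) y"
    using poly2_second_order_division[OF h open_ball] by blast
  define E0 where "E0 = E (0, 0)"
  have E0: "E0 \<noteq> 0" using E(3)[of 0] r h0 nz by (auto simp: E0_def)
  define \<rho> where "\<rho> = min r r'"
  have \<rho>: "\<rho> > 0" "ball 0 \<rho> \<subseteq> ball (0::complex) r" "ball 0 \<rho> \<subseteq> ball (0::complex) r'"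
    using r r' by (auto simp: \<rho>_def)
  define U where "U = (UNIV \<times> ball 0 \<rho>) \<inter> (\<lambda>p. E p / E0) -` (- \<real>\<^sub>\<le>\<^sub>0)"
  have E': "C1_holomorphic2_on (\<lambda>p. E p * (1 / E0)) (UNIV \<times> ball 0 \<rho>)"
    by (intro C1_intros C1_holomorphic2_on_subset[OF E(1)]) (use \<rho> in auto)
  have "open U"
    unfolding U_def using C1_holomorphic2_on_imp_continuous_on[OF E']
    by (intro continuous_open_preimage open_Times) auto
  have U0: "(0, 0) \<in> U" using \<rho> E0 by (simp add: U_def E0_def)
  \<comment> \<open>Dividing by \<open>E0\<close> moves the argument of the root to 1, away from the branch cut, whatever \<open>E0\<close> is.\<close>
  define S where "S = (\<lambda>p. csqrt E0 * csqrt (E p * (1 / E0)))"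
  have S2: "(S p)\<^sup>2 = E p" for p
    using E0 by (simp add: S_def power_mult_distrib)
  have S0: "S (0, 0) \<noteq> 0" using S2[of "(0, 0)"] E0 by (auto simp: E0_def)
  have "csqrt holomorphic_on - \<real>\<^sub>\<le>\<^sub>0"
    by (rule holomorphic_on_csqrt)
  then have "C1_holomorphic2_on (\<lambda>p. csqrt (E p * (1 / E0))) U"
    by (rule C1_holomorphic2_on_compose[OF _ _ C1_holomorphic2_on_subset[OF E']]) (auto simp: U_def)
  then have S: "C1_holomorphic2_on S U"
    unfolding S_def by (intro C1_intros)
  have hsnd: "C1_holomorphic2_on (\<lambda>p. h (snd p)) U"
    by (rule C1_holomorphic2_on_compose[OF h open_ball C1_holomorphic2_on_snd])
       (use \<rho> in \<open>auto simp: U_def\<close>)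
  have gsnd: "C1_holomorphic2_on (\<lambda>p. g (snd p)) U"
    by (rule C1_holomorphic2_on_compose[OF g open_ball C1_holomorphic2_on_snd])
       (use \<rho> in \<open>auto simp: U_def\<close>)
  define A where "A = (\<lambda>p. (fst p - h (snd p)) * S p)"
  define B where "B = (\<lambda>p :: complex \<times> complex. snd p * g (snd p))"
  have A: "C1_holomorphic2_on A U" and B: "C1_holomorphic2_on B U"
    unfolding A_def B_def by (intro C1_intros S hsnd gsnd)+
  obtain s t where dS: "(S has_derivative (\<lambda>v. s * fst v + t * snd v)) (at (0, 0))"
    using S U0 unfolding C1_holomorphic2_on_def by blast
  have dsnd: "(snd has_derivative snd) (at (0 :: complex, 0 :: complex))"
    by (auto intro!: derivative_eq_intros)
  have "((\<lambda>p. h (snd p)) has_derivative (\<lambda>v. deriv h 0 * snd v)) (at (0 :: complex, 0))"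
    using has_derivative_compose[OF dsnd, of h "(*) (deriv h 0)"] dh[of 0] r
    by (simp add: has_field_derivative_def)
  then have dA: "(A has_derivative (\<lambda>v. S (0, 0) * fst v + (- deriv h 0 * S (0, 0)) * snd v)) (at (0, 0))"
    unfolding A_def
    by (auto intro!: derivative_eq_intros dS simp: h0 algebra_simps)
  have dg: "(g has_field_derivative deriv g 0) (at 0)"
    using g r' holomorphic_derivI[of g "ball 0 r'" 0] by simp
  have "((\<lambda>p. g (snd p)) has_derivative (\<lambda>v. deriv g 0 * snd v)) (at (0 :: complex, 0))"
    using has_derivative_compose[OF dsnd, of g "(*) (deriv g 0)"] dg
    by (simp add: has_field_derivative_def)
  then have dB: "(B has_derivative (\<lambda>v. 0 * fst v + g 0 * snd v)) (at (0, 0))"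
    unfolding B_def
    by (auto intro!: derivative_eq_intros simp: algebra_simps)
  obtain U' V \<psi> where UV: "U' \<subseteq> U" "(0, 0) \<in> U'" "biholomorphism2 U' V (\<lambda>q. (A q, B q)) \<psi>"
    by (rule holomorphic2_inverse_function[OF \<open>open U\<close> U0 A B dA dB]) (use S0 g0[of 0] r' in auto)
  have normal: "f Q q - f Q (0, 0) = (A q)\<^sup>2 + (B q) ^ (n - 1 + 1)" if "q \<in> U'" for q
  proof -
    obtain x y where q: "q = (x, y)" by (cases q)
    have y: "y \<in> ball 0 r" "y \<in> ball 0 r'" using UV(1) that q \<rho> by (auto simp: U_def)
    have "f Q q = \<phi> y + (x - h y)\<^sup>2 * E (x, y)"
      using E(2)[OF y(1), of x] Qx[OF y(1)] by (simp add: f_def q \<phi>_def)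
    moreover have "f Q (0, 0) = \<phi> 0" by (simp add: f_def \<phi>_def h0)
    moreover have "(A q)\<^sup>2 = (x - h y)\<^sup>2 * E (x, y)" by (simp add: A_def q power_mult_distrib S2)
    moreover have "(B q) ^ n = \<phi> y - \<phi> 0" using \<phi>g[OF y(2)] by (simp add: B_def q)
    ultimately show ?thesis using n2 by simp
  qed
  have "type_A (n - 1) (f Q) (0, 0)"
    unfolding type_A_def
    by (intro conjI iso exI[of _ U'] exI[of _ V] exI[of _ "\<lambda>q. (A q, B q)"] exI[of _ \<psi>] UV)
       (use n2 normal in \<open>auto simp: A_def B_def h0\<close>)
  moreover have "n - 1 = 1"
    if det: "poly2 (pderiv_x (pderiv_x Q)) 0 0 * poly2 (pderiv_y (pderiv_y Q)) 0 0 - (poly2 (pderiv_x (pderiv_y Q)) 0 0)\<^sup>2 \<noteq> 0"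
  proof (rule ccontr)
    assume "n - 1 \<noteq> 1"
    then have "(deriv ^^ 2) \<phi> 0 = 0" using n2 by (intro least) auto
    then have dd0: "deriv (deriv \<phi>) 0 = 0" by (simp add: numeral_2_eq_2)
    have "(deriv \<phi> has_field_derivative
        poly2 (pderiv_x (pderiv_y Q)) (h 0) 0 * deriv h 0 + poly2 (pderiv_y (pderiv_y Q)) (h 0) 0) (at 0)"
      by (rule has_field_derivative_transform_within_open[OF
            poly2_along_graph_has_derivative[OF dh] open_ball[of 0 r]])
         (use r in \<open>auto intro!: DERIV_imp_deriv[OF d\<phi>, symmetric]\<close>)
    then have 1: "poly2 (pderiv_x (pderiv_y Q)) 0 0 * deriv h 0 + poly2 (pderiv_y (pderiv_y Q)) 0 0 = 0"
      using dd0 by (simp add: DERIV_imp_deriv h0)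
    have "((\<lambda>y. poly2 (pderiv_x Q) (h y) y) has_field_derivative 0) (at 0)"
      by (rule has_field_derivative_transform_within_open[of "\<lambda>_. 0" _ _ "ball 0 r"])
         (use r Qx in auto)
    then have 2: "poly2 (pderiv_x (pderiv_x Q)) 0 0 * deriv h 0 + poly2 (pderiv_x (pderiv_y Q)) 0 0 = 0"
      using poly2_along_graph_has_derivative[OF dh[of 0], of "pderiv_x Q"] r h0
      by (auto simp: pderiv_x_pderiv_y_commute dest: DERIV_unique)
    \<comment> \<open>Eliminating \<open>h'(0)\<close> from the two equations makes the Hessian determinant vanish.\<close>
    from 1 2 det show False by algebra
  qed
  ultimately show thesis using that by blast
qed

section \<open>Critical points with nonzero Hessian\<close>

lemma pderiv_x_smult: "pderiv_x (smult [:a:] Q) = smult [:a:] (pderiv_x Q)"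
  by (intro poly_eqI) (simp add: coeff_pderiv_x)

lemma pderiv_y_smult: "pderiv_y (smult [:a:] Q) = smult [:a:] (pderiv_y Q)"
  by (intro poly_eqI) (simp add: coeff_pderiv_y)

lemma poly2_smult: "poly2 (smult [:a:] Q) x y = a * poly2 Q x y"
  by (simp add: poly2_def)

lemma poly2_affine_hessian:
  assumes R: "\<And>x y. poly2 R x y = poly2 Q (e + a * x + b * y) (f + c * x + d * y)"
  shows "poly2 (pderiv_x (pderiv_x R)) 0 0 =
      poly2 (pderiv_x (pderiv_x Q)) e f * a\<^sup>2 + 2 * poly2 (pderiv_x (pderiv_y Q)) e f * a * c + poly2 (pderiv_y (pderiv_y Q)) e f * c\<^sup>2" (is ?xx)
    and "poly2 (pderiv_x (pderiv_x R)) 0 0 * poly2 (pderiv_y (pderiv_y R)) 0 0 - (poly2 (pderiv_x (pderiv_y R)) 0 0)\<^sup>2 =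
      (poly2 (pderiv_x (pderiv_x Q)) e f * poly2 (pderiv_y (pderiv_y Q)) e f - (poly2 (pderiv_x (pderiv_y Q)) e f)\<^sup>2) * (a * d - b * c)\<^sup>2" (is ?det)
proof -
  have Rx: "poly2 (pderiv_x R) x y =
      poly2 (smult [:a:] (pderiv_x Q) + smult [:c:] (pderiv_y Q)) (e + a * x + b * y) (f + c * x + d * y)" for x y
    using poly2_affine_chain_rule(1)[OF R] by (simp add: poly2_add poly2_smult algebra_simps)
  have Ry: "poly2 (pderiv_y R) x y =
      poly2 (smult [:b:] (pderiv_x Q) + smult [:d:] (pderiv_y Q)) (e + a * x + b * y) (f + c * x + d * y)" for x y
    using poly2_affine_chain_rule(2)[OF R] by (simp add: poly2_add poly2_smult algebra_simps)
  have xx: "poly2 (pderiv_x (pderiv_x R)) 0 0 = (a * poly2 (pderiv_x (pderiv_x Q)) e f + c * poly2 (pderiv_x (pderiv_y Q)) e f) * a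
      + (a * poly2 (pderiv_x (pderiv_y Q)) e f + c * poly2 (pderiv_y (pderiv_y Q)) e f) * c"
    using poly2_affine_chain_rule(1)[OF Rx, of 0 0]
    by (simp add: pderiv_x_add pderiv_y_add pderiv_x_smult pderiv_y_smult poly2_add poly2_smult pderiv_x_pderiv_y_commute)
  have xy: "poly2 (pderiv_x (pderiv_y R)) 0 0 = (b * poly2 (pderiv_x (pderiv_x Q)) e f + d * poly2 (pderiv_x (pderiv_y Q)) e f) * a
      + (b * poly2 (pderiv_x (pderiv_y Q)) e f + d * poly2 (pderiv_y (pderiv_y Q)) e f) * c"
    using poly2_affine_chain_rule(1)[OF Ry, of 0 0]
    by (simp add: pderiv_x_add pderiv_y_add pderiv_x_smult pderiv_y_smult poly2_add poly2_smult pderiv_x_pderiv_y_commute)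
  have yy: "poly2 (pderiv_y (pderiv_y R)) 0 0 = (b * poly2 (pderiv_x (pderiv_x Q)) e f + d * poly2 (pderiv_x (pderiv_y Q)) e f) * b
      + (b * poly2 (pderiv_x (pderiv_y Q)) e f + d * poly2 (pderiv_y (pderiv_y Q)) e f) * d"
    using poly2_affine_chain_rule(2)[OF Ry, of 0 0]
    by (simp add: pderiv_x_add pderiv_y_add pderiv_x_smult pderiv_y_smult poly2_add poly2_smult pderiv_x_pderiv_y_commute)
  show ?xx unfolding xx by algebra
  show ?det unfolding xx xy yy by algebra
qed

text \<open>
  A quadratic form with a nonzero coefficient is nonzero on \<open>(1, 0)\<close>, \<open>(0, 1)\<close> or \<open>(1, 1)\<close>; the
  vector \<open>(a, c)\<close> found there is completed to a basis by \<open>(b, d)\<close>.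
\<close>

lemma nonzero_quadratic_form_direction:
  assumes "A \<noteq> 0 \<or> B \<noteq> 0 \<or> C \<noteq> (0::complex)"
  obtains a b c d where "a * d - b * c \<noteq> 0" "A * a\<^sup>2 + 2 * B * a * c + C * c\<^sup>2 \<noteq> 0"
proof (cases "A \<noteq> 0")
  case True
  then show thesis using that[of 1 1 0 0] by simp
next
  case A: False
  show thesis
  proof (cases "C \<noteq> 0")
    case True
    then show thesis using that[of 0 0 1 1] by simp
  next
    case False
    then show thesis using A assms that[of 1 1 0 1] by simp
  qed
qed

text \<open>
  The splitting lemma needs a nonzero second derivative in the first coordinate direction at the
  origin. A suitable affine map \<open>L\<close> arranges this, and the normal form found for \<open>F \<circ> L\<close> is carried
  back along the inverse of \<open>L\<close>. The Hessian determinant only changes by the factor \<open>(det L)\<^sup>2\<close>, so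
  the criterion for nondegeneracy survives.
\<close>

lemma type_A_at_nonzero_hessian:
  fixes Q e f
  defines "F \<equiv> \<lambda>p. poly2 Q (fst p) (snd p)"
  defines "Hxx \<equiv> poly2 (pderiv_x (pderiv_x Q)) e f" and "Hxy \<equiv> poly2 (pderiv_x (pderiv_y Q)) e f"
    and "Hyy \<equiv> poly2 (pderiv_y (pderiv_y Q)) e f"
  assumes iso: "isolated_critical_point F (e, f)"
    and nz: "Hxx \<noteq> 0 \<or> Hxy \<noteq> 0 \<or> Hyy \<noteq> 0"
  obtains k where "type_A k F (e, f)" "Hxx * Hyy - Hxy\<^sup>2 \<noteq> 0 \<Longrightarrow> k = 1"
proof -
  obtain a b c d where det: "a * d - b * c \<noteq> 0"
    and dir: "Hxx * a\<^sup>2 + 2 * Hxy * a * c + Hyy * c\<^sup>2 \<noteq> 0"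
    by (rule nonzero_quadratic_form_direction[OF nz])
  obtain R where R: "\<And>x y. poly2 R x y = poly2 Q (e + a * x + b * y) (f + c * x + d * y)"
    using poly2_affine_substitution by blast
  define G where "G = (\<lambda>p. poly2 R (fst p) (snd p))"
  define L where "L = (\<lambda>p. (e + a * fst p + b * snd p, f + c * fst p + d * snd p))"
  obtain M where bihol: "biholomorphism2 UNIV UNIV M L"
    using biholomorphism2_affine[OF det, of e f] unfolding L_def by blast
  then have hom: "homeomorphism UNIV UNIV M L"
    by (simp add: biholomorphism2_def)
  have inv: "M (L q) = q" "L (M q) = q" for q
    using homeomorphism_apply1[OF hom] homeomorphism_apply2[OF hom] by simp_all
  have L0: "L (0, 0) = (e, f)" by (simp add: L_def)
  have M0: "M (e, f) = (0, 0)" using inv(1)[of "(0, 0)"] L0 by simp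
  have GF: "G q = F (L q)" for q by (simp add: G_def F_def L_def R)
  have crit: "critical_point F (L q)" if "critical_point G q" for q
  proof -
    have "poly2 (pderiv_x Q) (fst (L q)) (snd (L q)) * a + poly2 (pderiv_y Q) (fst (L q)) (snd (L q)) * c = 0"
      "poly2 (pderiv_x Q) (fst (L q)) (snd (L q)) * b + poly2 (pderiv_y Q) (fst (L q)) (snd (L q)) * d = 0"
      using that poly2_affine_chain_rule[OF R, of "fst q" "snd q"]
      unfolding G_def critical_point_poly2_iff L_def by simp_all
    then have "poly2 (pderiv_x Q) (fst (L q)) (snd (L q)) * (a * d - b * c) = 0"
      "poly2 (pderiv_y Q) (fst (L q)) (snd (L q)) * (a * d - b * c) = 0" by algebra+
    then show ?thesis using det unfolding F_def critical_point_poly2_iff by simp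
  qed
  have isoG: "isolated_critical_point G (0, 0)"
  proof -
    obtain T where T: "open T" "T \<inter> {q. critical_point F q} = {(e, f)}"
      using iso unfolding isolated_critical_point_def isolated_in_def by auto
    have "critical_point F (e, f)" using T(2) by blast
    then have "critical_point G (0, 0)"
      unfolding G_def F_def critical_point_poly2_iff
      using poly2_affine_chain_rule[OF R, of 0 0] by simp
    moreover have "open (L -` T)"
      using T(1) bihol by (intro open_vimage) (auto simp: biholomorphism2_def homeomorphism_def)
    moreover have "q = (0, 0)" if "q \<in> L -` T" "critical_point G q" for q
    proof -
      have "L q = (e, f)" using T(2) that crit[of q] by auto
      then show ?thesis using inv(1)[of q] M0 by simp
    qed
    moreover have "(0, 0) \<in> L -` T" using T(2) L0 by auto
    ultimately have "L -` T \<inter> {q. critical_point G q} = {(0, 0)}" by blast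
    then show ?thesis
      unfolding isolated_critical_point_def
      using isolated_inI[OF _ \<open>open (L -` T)\<close>, of "(0, 0)"] \<open>critical_point G (0, 0)\<close> by blast
  qed
  have Rxx: "poly2 (pderiv_x (pderiv_x R)) 0 0 \<noteq> 0"
    using dir unfolding poly2_affine_hessian(1)[OF R] Hxx_def Hxy_def Hyy_def .
  obtain k where k: "type_A k G (0, 0)"
    "poly2 (pderiv_x (pderiv_x R)) 0 0 * poly2 (pderiv_y (pderiv_y R)) 0 0 - (poly2 (pderiv_x (pderiv_y R)) 0 0)\<^sup>2 \<noteq> 0 \<Longrightarrow> k = 1"
  proof (rule splitting_lemma[OF isoG[unfolded G_def] Rxx, folded G_def])
    fix k
    assume "type_A k G (0, 0)"
      "poly2 (pderiv_x (pderiv_x R)) 0 0 * poly2 (pderiv_y (pderiv_y R)) 0 0 - (poly2 (pderiv_x (pderiv_y R)) 0 0)\<^sup>2 \<noteq> 0 \<Longrightarrow> k = 1"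
    then show thesis by (rule that)
  qed
  obtain U V \<phi> \<psi> where UV: "biholomorphism2 U V \<phi> \<psi>" "(0, 0) \<in> U" "\<phi> (0, 0) = (0, 0)"
    "\<And>q. q \<in> U \<Longrightarrow> G q - G (0, 0) = fst (\<phi> q) ^ 2 + snd (\<phi> q) ^ (k + 1)" and k1: "k \<ge> 1"
    using k(1) unfolding type_A_def by blast
  have "F q - F (e, f) = fst ((\<phi> \<circ> M) q) ^ 2 + snd ((\<phi> \<circ> M) q) ^ (k + 1)" if "q \<in> M -` U" for q
    using UV(4)[of "M q"] that by (simp add: GF inv L0)
  then have "type_A k F (e, f)"
    unfolding type_A_def using biholomorphism2_compose_global[OF bihol UV(1)] k1 iso UV(2,3) M0
    by (intro conjI exI[of _ "M -` U"] exI[of _ V] exI[of _ "\<phi> \<circ> M"] exI[of _ "L \<circ> \<psi>"]) auto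
  moreover have "k = 1" if "Hxx * Hyy - Hxy\<^sup>2 \<noteq> 0"
    using that det by (intro k(2)) (simp add: poly2_affine_hessian(2)[OF R] Hxx_def Hxy_def Hyy_def)
  ultimately show thesis using that by blast
qed

section \<open>Homogeneous polynomials and the theorem\<close>

lemma euler_homogeneous2:
  assumes "homogeneous2 d P"
  shows "x * poly2 (pderiv_x P) x y + y * poly2 (pderiv_y P) x y = of_nat d * poly2 P x y"
proof -
  have "smult [:0, 1:] (pderiv_x P) + pCons 0 (pderiv_y P) = smult [:of_nat d:] P"
  proof (intro poly_eqI)
    fix j i
    have "coeff (coeff P j) i * (of_nat i + of_nat j) = coeff (coeff P j) i * of_nat d"
      using assms unfolding homogeneous2_def by (cases "coeff (coeff P j) i = 0") (auto simp flip: of_nat_add)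
    then show "coeff (coeff (smult [:0, 1:] (pderiv_x P) + pCons 0 (pderiv_y P)) j) i =
        coeff (coeff (smult [:of_nat d:] P) j) i"
      by (cases i; cases j) (simp_all add: coeff_pderiv_x coeff_pderiv_y algebra_simps)
  qed
  then have "poly2 (smult [:0, 1:] (pderiv_x P) + pCons 0 (pderiv_y P)) x y = poly2 (smult [:of_nat d:] P) x y"
    by simp
  then show ?thesis by (simp add: poly2_def)
qed

lemma homogeneous2_pderiv_x: "homogeneous2 (Suc d) P \<Longrightarrow> homogeneous2 d (pderiv_x P)"
  unfolding homogeneous2_def coeff_pderiv_x by (metis add_Suc diff_Suc_1 mult_zero_right)

lemma homogeneous2_pderiv_y: "homogeneous2 (Suc d) P \<Longrightarrow> homogeneous2 d (pderiv_y P)"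
  unfolding homogeneous2_def coeff_pderiv_y by (metis add_Suc_right diff_Suc_1 mult_zero_right)

lemma homogeneous2_vanishes_at_origin:
  assumes "homogeneous2 d P" "d > 0"
  shows "poly2 P 0 0 = 0"
  using euler_homogeneous2[OF assms(1), of 0 0] assms(2) by simp

text \<open>
  Euler's relation for \<open>P\<close> controls the values of \<open>H\<close> at critical points; applied to the partial
  derivatives of \<open>P\<close>, it controls the Hessian there.
\<close>

theorem theorem2:
  fixes n :: nat
    and P :: "complex poly poly"
    and H :: "complex \<times> complex \<Rightarrow> complex"
  assumes "n \<ge> 2"
    and "homogeneous2 (n + 1) P"
    and "\<And>x y. H (x, y) = x * y + poly2 P x y"
  shows "(\<forall>p. isolated_critical_point H p \<longrightarrow> (\<exists>k\<ge>1. type_A k H p)) \<and>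
         (\<forall>p. isolated_critical_point H p \<and> p \<in> {(x, y). H (x, y) = 0} \<longrightarrow> type_A 1 H p)"
proof -
  obtain m where m: "n = Suc (Suc m)" by (rule that[of "n - 2"]) (use assms(1) in simp)
  define XY :: "complex poly poly" where "XY = [:0, [:0, 1:]:]"
  define Q where "Q = XY + P"
  have H: "H = (\<lambda>p. poly2 Q (fst p) (snd p))"
    by (auto simp: fun_eq_iff assms(3) Q_def XY_def poly2_add) (simp add: poly2_def)
  have XY: "pderiv_x XY = [:0, 1:]" "pderiv_y XY = [:[:0, 1:]:]"
    by (simp_all add: XY_def pderiv_x_def pderiv_y_def pderiv_pCons map_poly_pCons one_pCons)
  have XY2: "pderiv_x [:0, 1:] = 0" "pderiv_y [:0, 1:] = 1" "pderiv_x [:[:0, 1:]:] = 1" "pderiv_y [:[:0, 1:]:] = 0"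
    by (simp_all add: pderiv_x_def pderiv_y_def pderiv_pCons map_poly_pCons one_pCons)
  have Qx: "poly2 (pderiv_x Q) x y = y + poly2 (pderiv_x P) x y"
    and Qy: "poly2 (pderiv_y Q) x y = x + poly2 (pderiv_y P) x y"
    and Qxx: "poly2 (pderiv_x (pderiv_x Q)) x y = poly2 (pderiv_x (pderiv_x P)) x y"
    and Qxy: "poly2 (pderiv_x (pderiv_y Q)) x y = 1 + poly2 (pderiv_x (pderiv_y P)) x y"
    and Qyy: "poly2 (pderiv_y (pderiv_y Q)) x y = poly2 (pderiv_y (pderiv_y P)) x y" for x y
    by (simp_all add: Q_def pderiv_x_add pderiv_y_add XY XY2 poly2_add) (simp_all add: poly2_def)
  have hP: "homogeneous2 (Suc n) P" using assms(2) by simp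
  note hPx = homogeneous2_pderiv_x[OF hP] and hPy = homogeneous2_pderiv_y[OF hP]
  note eulerP = euler_homogeneous2[OF hP]
    and eulerPx = euler_homogeneous2[OF hPx, folded pderiv_x_pderiv_y_commute]
    and eulerPy = euler_homogeneous2[OF hPy]
  have origin: "poly2 (pderiv_x (pderiv_x P)) 0 0 = 0" "poly2 (pderiv_x (pderiv_y P)) 0 0 = 0" "poly2 (pderiv_y (pderiv_y P)) 0 0 = 0"
    using homogeneous2_vanishes_at_origin[OF homogeneous2_pderiv_x[OF hPx[unfolded m]]]
      homogeneous2_vanishes_at_origin[OF homogeneous2_pderiv_x[OF hPy[unfolded m]]]
      homogeneous2_vanishes_at_origin[OF homogeneous2_pderiv_y[OF hPy[unfolded m]]] by simp_all
  have n1: "(of_nat n :: complex) \<noteq> 1" unfolding of_nat_eq_1_iff using assms(1) by simp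
  have result: "\<exists>k\<ge>1. type_A k H (x, y) \<and> (H (x, y) = 0 \<longrightarrow> k = 1)"
    if iso: "isolated_critical_point H (x, y)" for x y
  proof -
    define N where "N = (of_nat n :: complex)"
    define gx gy gxx gxy gyy where "gx = poly2 (pderiv_x P) x y" and "gy = poly2 (pderiv_y P) x y"
      and "gxx = poly2 (pderiv_x (pderiv_x P)) x y" and "gxy = poly2 (pderiv_x (pderiv_y P)) x y" and "gyy = poly2 (pderiv_y (pderiv_y P)) x y"
    have N1: "N - 1 \<noteq> 0" using n1 by (simp add: N_def)
    have "critical_point H (x, y)"
      using iso unfolding isolated_critical_point_def isolated_in_def by simp
    then have gx: "gx = - y" and gy: "gy = - x"
      unfolding H critical_point_poly2_iff by (simp_all add: Qx Qy gx_def gy_def eq_neg_iff_add_eq_0 add.commute)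
    have ex: "x * gxx + y * gxy = N * gx" and ey: "x * gxy + y * gyy = N * gy"
      using eulerPx[of x y] eulerPy[of x y] by (simp_all add: gx_def gy_def gxx_def gxy_def gyy_def N_def)
    \<comment> \<open>With Hessian zero, Euler's relations for the gradient of \<open>P\<close> read \<open>- y = - n y\<close> and \<open>- x = - n x\<close>.\<close>
    have nz: "gxx \<noteq> 0 \<or> 1 + gxy \<noteq> 0 \<or> gyy \<noteq> 0"
    proof (rule ccontr)
      assume "\<not> ?thesis"
      then have z: "gxx = 0" "gxy = - 1" "gyy = 0" by (simp_all add: eq_neg_iff_add_eq_0 add.commute)
      have "(N - 1) * y = 0" "(N - 1) * x = 0" using ex ey gx gy z by algebra+
      then have "x = 0" "y = 0" using N1 by simp_all
      then show False using z(2) origin(2) by (simp add: gxy_def)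
    qed
    obtain k where k: "type_A k H (x, y)" "gxx * gyy - (1 + gxy)\<^sup>2 \<noteq> 0 \<Longrightarrow> k = 1"
    proof (rule type_A_at_nonzero_hessian[OF iso[unfolded H], folded H, unfolded Qxx Qxy Qyy])
      show "poly2 (pderiv_x (pderiv_x P)) x y \<noteq> 0 \<or> 1 + poly2 (pderiv_x (pderiv_y P)) x y \<noteq> 0 \<or> poly2 (pderiv_y (pderiv_y P)) x y \<noteq> 0"
        using nz unfolding gxx_def gxy_def gyy_def .
    next
      fix k
      assume "type_A k H (x, y)"
        "poly2 (pderiv_x (pderiv_x P)) x y * poly2 (pderiv_y (pderiv_y P)) x y - (1 + poly2 (pderiv_x (pderiv_y P)) x y)\<^sup>2 \<noteq> 0 \<Longrightarrow> k = 1"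
      then show thesis unfolding gxx_def[symmetric] gxy_def[symmetric] gyy_def[symmetric] by (rule that)
    qed
    have "gxx * gyy - (1 + gxy)\<^sup>2 \<noteq> 0" if H0: "H (x, y) = 0"
    proof -
      have "x * gx + y * gy = (N + 1) * (H (x, y) - x * y)"
        using eulerP[of x y] by (simp add: gx_def gy_def N_def assms(3) algebra_simps)
      \<comment> \<open>Thus a critical point of value 0 lies on a coordinate axis. Off the origin the mixed derivative there is \<open>1 - n\<close> and one of the pure ones vanishes.\<close>
      then have "(N - 1) * (x * y) = 0" using H0 gx gy by algebra
      then consider "x = 0" "y = 0" | "x \<noteq> 0" "y = 0" | "x = 0" "y \<noteq> 0" using N1 by auto
      then show ?thesis
      proof cases
        case 1
        then show ?thesis using origin by (simp add: gxx_def gxy_def gyy_def)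
      next
        case 2
        then have "gxx = 0" using ex gx by simp
        have "x * (gxy + N) = 0" using 2 ey gy by algebra
        then have "gxy = - N" using 2 by (simp add: add_eq_0_iff2)
        with \<open>gxx = 0\<close> show ?thesis using N1 by simp
      next
        case 3
        then have "gyy = 0" using ey gy by simp
        have "y * (gxy + N) = 0" using 3 ex gx by algebra
        then have "gxy = - N" using 3 by (simp add: add_eq_0_iff2)
        with \<open>gyy = 0\<close> show ?thesis using N1 by simp
      qed
    qed
    moreover have "k \<ge> 1" using k(1) by (simp add: type_A_def)
    ultimately show ?thesis using k by blast
  qed
  show ?thesis
  proof (intro conjI allI impI)
    fix p assume "isolated_critical_point H p"
    then show "\<exists>k\<ge>1. type_A k H p" using result by (metis prod.collapse)
  next
    fix p assume p: "isolated_critical_point H p \<and> p \<in> {(x, y). H (x, y) = 0}"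
    then show "type_A 1 H p" using result[of "fst p" "snd p"] by auto
  qed
qed

end
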